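(* In the setting below, assume $\Omega\neq\emptyset$. Then the Algorithm terminates after a finite number of iterations, and its output $(\bar x^*,R^* )$ satisfies: $\bar x^*\in\Omega$ is a robust solution, i.e. $R_{\bar x^*}=\min_{x\in\Omega}R_x$ (equivalently, it is optimal for the problem $\mathcal{F}$ of minimizing $\sum_i u_ix_i-\rho$ subject to $\rho\le\sum_i(l_i+(u_i-l_i)x_i)\bar y_i$ for all $\bar y\in\Omega$, $x\in\Omega$, $\rho$ free), and $R^*=R_{\bar x^*}$ is its robustness cost.
   Context: Let $A$ be an $m\times n$ real matrix, $b\in\mathbb{R}^m$, $\Omega=\{x\in\{0,1\}^n: Ax\ge b\}$, and for $i=1,\dots,n$ let $l_i,u_i\in\mathbb{Z}_+$ with $l_i\le u_i$; write $u=(u_1,\dots,u_n)$. A scenario $s$ is a cost vector $c^s\in\prod_i[l_i,u_i]$; $opt(s)$ is a minimizer of $c^sy=\sum_i c^s_iy_i$ over $y\in\Omega$. The scenario $s(x)$ induced by $x\in\Omega$ has $c^{s(x)}_i=u_i$ if $x_i=1$ and $l_i$ if $x_i=0$; the robustness cost of $x\in\Omega$ is $R_x=\max_{s}(c^sx-c^s\,opt(s))$, which equals $c^{s(x)}x-c^{s(x)}opt(s(x))$. The worst-case scenario $s_u$ has $c^{s_u}=u$. For $\Omega'\subseteq\Omega$, the master problem $\mathcal{F}(\Omega')$ is: minimize $\sum_i u_ix_i-\rho$ subject to $\rho\le\sum_i(l_i+(u_i-l_i)x_i)\bar y_i$ for all $\bar y\in\Omega'$, $x\in\Omega$, $\rho\in\mathbb{R}$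 free. The Algorithm: Step I: set $\psi:=1$, compute an optimal solution $y_u=opt(s_u)$ and set $\Omega^1:=\{y_u\}$. Step II: solve $\mathcal{F}(\Omega^{\psi})$ to optimality, obtaining $(\bar x^{\psi},\bar\rho^{\psi})$. Step III (separation subproblem): compute an optimal solution $\bar y^{\psi}=opt(s(\bar x^{\psi}))$ and $R_{\bar x^{\psi}}=c^{s(\bar x^{\psi})}\bar x^{\psi}-c^{s(\bar x^{\psi})}\bar y^{\psi}$. Step IV: set $lb^{\psi}:=u\bar x^{\psi}-\bar\rho^{\psi}$; if $lb^{\psi}\ge R_{\bar x^{\psi}}$ (stopping condition), return $(\bar x^*,R^* ):=(\bar x^{\psi},R_{\bar x^{\psi}})$; otherwise set $\Omega^{\psi+1}:=\Omega^{\psi}\cup\{\bar y^{\psi}\}$, $\psi:=\psi+1$, and go to Step II. *)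

theory Defs
  imports "HOL-Analysis.Analysis"
begin

definition feasible_set :: "real^'n^'m \<Rightarrow> real^'m \<Rightarrow> (real^'n) set" where
  "feasible_set A b = {x. (\<forall>i. x $ i \<in> {0, 1}) \<and> (\<forall>j. (A *v x) $ j \<ge> b $ j)}"

definition scenarios :: "nat^'n \<Rightarrow> nat^'n \<Rightarrow> (real^'n) set" where
  "scenarios l u = {c. \<forall>i. c $ i \<in> {real (l $ i)..real (u $ i)}}"

text \<open>Minimizers need not be unique, so \<open>opt(s)\<close> is rendered as a relation: \<open>is_opt \<Omega> c y\<close>
  says that \<open>y\<close> is an admissible choice of \<open>opt(s)\<close> for the scenario \<open>s\<close> with cost vector \<open>c\<close>.\<close>

definition is_opt :: "(real^'n) set \<Rightarrow> real^'n \<Rightarrow> real^'n \<Rightarrow> bool" where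
  "is_opt \<Omega> c y \<longleftrightarrow> is_arg_min (\<lambda>y. c \<bullet> y) (\<lambda>y. y \<in> \<Omega>) y"

definition induced_scenario :: "nat^'n \<Rightarrow> nat^'n \<Rightarrow> real^'n \<Rightarrow> real^'n" where
  "induced_scenario l u x = (\<chi> i. if x $ i = 1 then real (u $ i) else real (l $ i))"

definition worst_case_scenario :: "nat^'n \<Rightarrow> real^'n" where
  "worst_case_scenario u = (\<chi> i. real (u $ i))"

text \<open>The maximum ranges over the infinite set of all scenarios, where \<open>Max\<close> is unspecified;
  \<open>Greatest\<close> denotes the maximum whenever it is attained, see \<open>robustness_cost_eq\<close> below.\<close>

definition robustness_cost :: "(real^'n) set \<Rightarrow> nat^'n \<Rightarrow> nat^'n \<Rightarrow> real^'n \<Rightarrow> real" where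
  "robustness_cost \<Omega> l u x =
     (GREATEST r. \<exists>c \<in> scenarios l u. \<exists>y. is_opt \<Omega> c y \<and> r = c \<bullet> x - c \<bullet> y)"

definition master_feasible ::
  "(real^'n) set \<Rightarrow> nat^'n \<Rightarrow> nat^'n \<Rightarrow> (real^'n) set \<Rightarrow> ((real^'n) \<times> real) set" where
  "master_feasible \<Omega> l u \<Omega>' =
     {(x, \<rho>). x \<in> \<Omega> \<and>
        (\<forall>y\<in>\<Omega>'. \<rho> \<le> (\<Sum>i\<in>UNIV. (real (l $ i) + (real (u $ i) - real (l $ i)) * x $ i) * y $ i))}"

definition master_objective :: "nat^'n \<Rightarrow> (real^'n) \<times> real \<Rightarrow> real" where
  "master_objective u = (\<lambda>(x, \<rho>). (\<Sum>i\<in>UNIV. real (u $ i) * x $ i) - \<rho>)"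

definition master_optimal ::
  "(real^'n) set \<Rightarrow> nat^'n \<Rightarrow> nat^'n \<Rightarrow> (real^'n) set \<Rightarrow> (real^'n) \<times> real \<Rightarrow> bool" where
  "master_optimal \<Omega> l u \<Omega>' p \<longleftrightarrow>
     is_arg_min (master_objective u) (\<lambda>q. q \<in> master_feasible \<Omega> l u \<Omega>') p"

text \<open>\<open>Running \<psi> \<Omega>'\<close> is the situation at the beginning of iteration \<open>\<psi>\<close>, before the master problem
  is solved, with \<open>\<Omega>' = \<Omega>\<^sup>\<psi>\<close>. One transition of \<open>alg_step\<close> is one full iteration: master problem,
  separation subproblem, stopping test. The relations are nondeterministic because an arbitrary
  optimal solution may be picked whenever a problem is solved.\<close>

datatype 'n alg_state =
    Running nat "(real^'n) set"
  | Returned "real^'n" real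

inductive alg_init :: "(real^'n) set \<Rightarrow> nat^'n \<Rightarrow> 'n alg_state \<Rightarrow> bool"
  for \<Omega> u where
  "is_opt \<Omega> (worst_case_scenario u) y \<Longrightarrow> alg_init \<Omega> u (Running 1 {y})"

inductive alg_step ::
  "(real^'n) set \<Rightarrow> nat^'n \<Rightarrow> nat^'n \<Rightarrow> 'n alg_state \<Rightarrow> 'n alg_state \<Rightarrow> bool"
  for \<Omega> l u where
  stop: "\<lbrakk>master_optimal \<Omega> l u \<Omega>' (x, \<rho>);
          c = induced_scenario l u x; is_opt \<Omega> c y; R = c \<bullet> x - c \<bullet> y;
          lb = (\<Sum>i\<in>UNIV. real (u $ i) * x $ i) - \<rho>; lb \<ge> R\<rbrakk>
         \<Longrightarrow> alg_step \<Omega> l u (Running \<psi> \<Omega>') (Returned x R)"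
| continue: "\<lbrakk>master_optimal \<Omega> l u \<Omega>' (x, \<rho>);
          c = induced_scenario l u x; is_opt \<Omega> c y; R = c \<bullet> x - c \<bullet> y;
          lb = (\<Sum>i\<in>UNIV. real (u $ i) * x $ i) - \<rho>; \<not> lb \<ge> R\<rbrakk>
         \<Longrightarrow> alg_step \<Omega> l u (Running \<psi> \<Omega>') (Running (\<psi> + 1) (\<Omega>' \<union> {y}))"

definition alg_reachable ::
  "(real^'n) set \<Rightarrow> nat^'n \<Rightarrow> nat^'n \<Rightarrow> 'n alg_state \<Rightarrow> bool" where
  "alg_reachable \<Omega> l u \<sigma> \<longleftrightarrow> (\<exists>\<sigma>\<^sub>0. alg_init \<Omega> u \<sigma>\<^sub>0 \<and> (alg_step \<Omega> l u)\<^sup>*\<^sup>* \<sigma>\<^sub>0 \<sigma>)"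

lemma finite_feasible_set: "finite (feasible_set (A :: real^'n^'m) b)"
proof (rule finite_subset)
  show "feasible_set A b \<subseteq> vec_lambda ` (PiE UNIV (\<lambda>_. {0, 1}))"
  proof
    fix x assume "x \<in> feasible_set A b"
    then have "vec_nth x \<in> PiE UNIV (\<lambda>_. {0, 1})" by (auto simp: feasible_set_def)
    then show "x \<in> vec_lambda ` (PiE UNIV (\<lambda>_. {0, 1}))"
      by (metis image_eqI vec_nth_inverse)
  qed
  show "finite (vec_lambda ` (PiE (UNIV :: 'n set) (\<lambda>_. {0, 1 :: real})))"
    by (intro finite_imageI finite_PiE) auto
qed

lemma robustness_cost_eq:
  fixes l u :: "nat^'n" and A :: "real^'n^'m"
  assumes lu: "\<And>i. l $ i \<le> u $ i" and x: "x \<in> feasible_set A b"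
    and y: "is_opt (feasible_set A b) (induced_scenario l u x) y"
  shows "robustness_cost (feasible_set A b) l u x =
           induced_scenario l u x \<bullet> x - induced_scenario l u x \<bullet> y"
  unfolding robustness_cost_def
proof (rule Greatest_equality)
  have "induced_scenario l u x \<in> scenarios l u"
    using lu by (auto simp: induced_scenario_def scenarios_def)
  then show "\<exists>c\<in>scenarios l u. \<exists>y'. is_opt (feasible_set A b) c y' \<and>
      induced_scenario l u x \<bullet> x - induced_scenario l u x \<bullet> y = c \<bullet> x - c \<bullet> y'"
    using y by blast
next
  fix r assume "\<exists>c\<in>scenarios l u. \<exists>y'. is_opt (feasible_set A b) c y' \<and> r = c \<bullet> x - c \<bullet> y'"
  then obtain c z where c: "c \<in> scenarios l u" and z: "is_opt (feasible_set A b) c z"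
    and r: "r = c \<bullet> x - c \<bullet> z" by blast
  let ?s = "induced_scenario l u x"
  have zf: "z \<in> feasible_set A b" using z by (simp add: is_opt_def is_arg_min_def)
  have "c $ i * (x $ i - z $ i) \<le> ?s $ i * (x $ i - z $ i)" for i
  proof -
    have "x $ i = 0 \<or> x $ i = 1" "z $ i = 0 \<or> z $ i = 1"
      using x zf by (auto simp: feasible_set_def)
    moreover have "real (l $ i) \<le> c $ i" "c $ i \<le> real (u $ i)"
      using c by (auto simp: scenarios_def)
    ultimately show ?thesis by (auto simp: induced_scenario_def)
  qed
  then have "c \<bullet> (x - z) \<le> ?s \<bullet> (x - z)"
    by (auto simp: inner_vec_def intro!: sum_mono)
  moreover have "?s \<bullet> y \<le> ?s \<bullet> z"
    using y zf by (auto simp: is_opt_def is_arg_min_linorder)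
  ultimately show "r \<le> ?s \<bullet> x - ?s \<bullet> y"
    unfolding r by (simp add: inner_diff_right)
qed

end

theory Submission
  imports Defs
begin

text \<open>For binary \<open>x\<close> the right-hand side of the cut given by \<open>y\<close> is the cost of \<open>y\<close> in the scenario
  induced by \<open>x\<close>. Hence \<open>(z, c z \<bullet> opt (c z))\<close>, with \<open>c z\<close> the scenario induced by \<open>z\<close>, satisfies every
  cut and has objective value \<open>R\<^sub>z\<close>, so the master value is a lower bound for all robustness costs;
  the stopping test says that this bound is attained at the current \<open>x\<close>.
  If the test fails, the separating solution violates its own cut and is therefore new,
  so the number of iterations is at most the cardinality of the finite feasible set.\<close>

section \<open>Binary vectors and their induced scenarios\<close>

lemma feasible_set_binary:
  "x \<in> feasible_set A b \<Longrightarrow> x $ i = 0 \<or> x $ i = 1"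
  by (auto simp: feasible_set_def)

text \<open>The affine coefficient takes the value \<open>l\<close> at 0 and \<open>u\<close> at 1.
  Only \<open>x\<close> is assumed binary, so \<open>y\<close> may come from any cut set.\<close>

lemma cut_eq_induced_scenario:
  assumes "x \<in> feasible_set A b"
  shows "(\<Sum>i\<in>UNIV. (real (l $ i) + (real (u $ i) - real (l $ i)) * x $ i) * y $ i)
           = induced_scenario l u x \<bullet> y"
  unfolding inner_vec_def
proof (rule sum.cong)
  fix i
  show "(real (l $ i) + (real (u $ i) - real (l $ i)) * x $ i) * y $ i
          = induced_scenario l u x $ i \<bullet> y $ i"
    using feasible_set_binary[OF assms, of i] by (auto simp: induced_scenario_def)
qed simp

text \<open>The two cost vectors agree wherever \<open>x $ i = 1\<close>, and other coordinates
  contribute 0. As \<open>l\<close> occurs only on the right, uses as a rewrite rule instantiate it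
  explicitly.\<close>

lemma induced_scenario_self:
  assumes "x \<in> feasible_set A b"
  shows "(\<Sum>i\<in>UNIV. real (u $ i) * x $ i) = induced_scenario l u x \<bullet> x"
  unfolding inner_vec_def
proof (rule sum.cong)
  fix i
  show "real (u $ i) * x $ i = induced_scenario l u x $ i \<bullet> x $ i"
    using feasible_set_binary[OF assms, of i] by (auto simp: induced_scenario_def)
qed simp

section \<open>Solvability and bounds for the master problem\<close>

lemma is_opt_exists:
  assumes "finite \<Omega>" "\<Omega> \<noteq> {}"
  shows "\<exists>y. is_opt \<Omega> c y"
  unfolding is_opt_def using ex_is_arg_min_if_finite[OF assms] .

lemma is_opt_iff: "is_opt \<Omega> c y \<longleftrightarrow> y \<in> \<Omega> \<and> (\<forall>z\<in>\<Omega>. c \<bullet> y \<le> c \<bullet> z)"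
  by (auto simp: is_opt_def is_arg_min_linorder)

lemma master_feasible_iff:
  "(x, \<rho>) \<in> master_feasible (feasible_set A b) l u \<Omega>' \<longleftrightarrow>
     x \<in> feasible_set A b \<and> (\<forall>y\<in>\<Omega>'. \<rho> \<le> induced_scenario l u x \<bullet> y)"
  by (auto simp: master_feasible_def cut_eq_induced_scenario)

lemma master_objective_eq:
  assumes "x \<in> feasible_set A b"
  shows "master_objective u (x, \<rho>) = induced_scenario l u x \<bullet> x - \<rho>"
  by (simp add: master_objective_def induced_scenario_self[OF assms, of u l])

lemma master_optimal_iff:
  "master_optimal \<Omega> l u \<Omega>' p \<longleftrightarrow> p \<in> master_feasible \<Omega> l u \<Omega>' \<and>
     (\<forall>q\<in>master_feasible \<Omega> l u \<Omega>'. master_objective u p \<le> master_objective u q)"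
  by (auto simp: master_optimal_def is_arg_min_linorder)

text \<open>The real variable \<open>\<rho>\<close> makes the feasible region infinite. For fixed
  \<open>x\<close> the best \<open>\<rho>\<close> is the smallest right-hand side of a cut, which
  exists because \<open>\<Omega>'\<close> is finite and nonempty; what remains is a minimum over
  finitely many \<open>x\<close>.\<close>

lemma master_optimal_exists:
  fixes A :: "real^'n^'m"
  assumes "feasible_set A b \<noteq> {}" "finite \<Omega>'" "\<Omega>' \<noteq> {}"
  shows "\<exists>p. master_optimal (feasible_set A b) l u \<Omega>' p"
proof -
  define \<rho> where "\<rho> x = Min ((\<lambda>y. induced_scenario l u x \<bullet> y) ` \<Omega>')" for x :: "real^'n"
  obtain x where "is_arg_min (\<lambda>x. induced_scenario l u x \<bullet> x - \<rho> x) (\<lambda>x. x \<in> feasible_set A b) x"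
    using ex_is_arg_min_if_finite[OF finite_feasible_set assms(1)] by blast
  then have x: "x \<in> feasible_set A b"
    and min: "\<And>z. z \<in> feasible_set A b \<Longrightarrow>
      induced_scenario l u x \<bullet> x - \<rho> x \<le> induced_scenario l u z \<bullet> z - \<rho> z"
    by (auto simp: is_arg_min_linorder)
  have "master_objective u (x, \<rho> x) \<le> master_objective u (z, r)"
    if "(z, r) \<in> master_feasible (feasible_set A b) l u \<Omega>'" for z r
  proof -
    have z: "z \<in> feasible_set A b" and "r \<le> \<rho> z"
      using that assms(2,3) by (auto simp: master_feasible_iff \<rho>_def)
    with min[OF z] show ?thesis
      by (simp add: master_objective_eq[OF x, of _ _ l] master_objective_eq[OF z, of _ _ l])
  qed
  moreover have "(x, \<rho> x) \<in> master_feasible (feasible_set A b) l u \<Omega>'"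
    using x assms(2) by (auto simp: master_feasible_iff \<rho>_def)
  ultimately have "master_optimal (feasible_set A b) l u \<Omega>' (x, \<rho> x)"
    unfolding master_optimal_iff by auto
  then show ?thesis by blast
qed

lemma master_value_le_robustness_cost:
  fixes l u :: "nat^'n" and A :: "real^'n^'m"
  assumes lu: "\<And>i. l $ i \<le> u $ i"
    and opt: "master_optimal (feasible_set A b) l u \<Omega>' p"
    and sub: "\<Omega>' \<subseteq> feasible_set A b" and z: "z \<in> feasible_set A b"
  shows "master_objective u p \<le> robustness_cost (feasible_set A b) l u z"
proof -
  obtain y where y: "is_opt (feasible_set A b) (induced_scenario l u z) y"
    using is_opt_exists[OF finite_feasible_set] z by blast
  \<comment> \<open>Since \<open>y\<close> minimises the induced cost over the whole feasible set,
    its cost lies below every cut from the subset \<open>\<Omega>'\<close>.\<close>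
  have "(z, induced_scenario l u z \<bullet> y) \<in> master_feasible (feasible_set A b) l u \<Omega>'"
    using y z sub by (auto simp: master_feasible_iff is_opt_iff)
  then have "master_objective u p \<le> master_objective u (z, induced_scenario l u z \<bullet> y)"
    using opt by (auto simp: master_optimal_iff)
  then show ?thesis
    using robustness_cost_eq[OF lu z y] by (simp add: master_objective_eq[OF z, of _ _ l])
qed

text \<open>With all cuts present, the optimal solution for the scenario induced by \<open>z\<close>
  supplies one of them, forcing \<open>\<rho>\<close> below the minimal cost in that
  scenario.\<close>

lemma robustness_cost_le_full_master_objective:
  fixes l u :: "nat^'n" and A :: "real^'n^'m"
  assumes lu: "\<And>i. l $ i \<le> u $ i"
    and feas: "(z, \<rho>) \<in> master_feasible (feasible_set A b) l u (feasible_set A b)"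
  shows "robustness_cost (feasible_set A b) l u z \<le> master_objective u (z, \<rho>)"
proof -
  have z: "z \<in> feasible_set A b" using feas by (simp add: master_feasible_iff)
  obtain y where y: "is_opt (feasible_set A b) (induced_scenario l u z) y"
    using is_opt_exists[OF finite_feasible_set] z by blast
  then have "\<rho> \<le> induced_scenario l u z \<bullet> y"
    using feas by (auto simp: master_feasible_iff is_opt_iff)
  then show ?thesis
    using robustness_cost_eq[OF lu z y] by (simp add: master_objective_eq[OF z, of _ _ l])
qed

text \<open>This links robustness to the full problem: taking \<open>\<rho>\<close> as the minimal
  cost in the scenario induced by \<open>x\<close> gives objective value R_x, while any feasible
  \<open>(z, r)\<close> has value at least R_z.\<close>

lemma robust_solution_master_optimal:
  fixes l u :: "nat^'n" and A :: "real^'n^'m"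
  assumes lu: "\<And>i. l $ i \<le> u $ i" and x: "x \<in> feasible_set A b"
    and robust: "\<And>z. z \<in> feasible_set A b \<Longrightarrow>
      robustness_cost (feasible_set A b) l u x \<le> robustness_cost (feasible_set A b) l u z"
  shows "\<exists>\<rho>. master_optimal (feasible_set A b) l u (feasible_set A b) (x, \<rho>)"
proof -
  obtain y where y: "is_opt (feasible_set A b) (induced_scenario l u x) y"
    using is_opt_exists[OF finite_feasible_set] x by blast
  let ?\<rho> = "induced_scenario l u x \<bullet> y"
  have eq: "master_objective u (x, ?\<rho>) = robustness_cost (feasible_set A b) l u x"
    using robustness_cost_eq[OF lu x y] by (simp add: master_objective_eq[OF x, of _ _ l])
  have "(x, ?\<rho>) \<in> master_feasible (feasible_set A b) l u (feasible_set A b)"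
    using x y by (auto simp: master_feasible_iff is_opt_iff)
  moreover have "master_objective u (x, ?\<rho>) \<le> master_objective u (z, r)"
    if "(z, r) \<in> master_feasible (feasible_set A b) l u (feasible_set A b)" for z r
    using robustness_cost_le_full_master_objective[OF lu that] robust[of z] that
    unfolding eq by (auto simp: master_feasible_iff)
  ultimately show ?thesis
    unfolding master_optimal_iff by auto
qed

section \<open>A single iteration\<close>

lemma alg_step_Returned_correct:
  fixes l u :: "nat^'n" and A :: "real^'n^'m"
  assumes lu: "\<And>i. l $ i \<le> u $ i"
    and step: "alg_step (feasible_set A b) l u (Running \<psi> \<Omega>') (Returned x R)"
    and sub: "\<Omega>' \<subseteq> feasible_set A b"
  shows "x \<in> feasible_set A b"
    and "R = robustness_cost (feasible_set A b) l u x"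
    and "\<And>z. z \<in> feasible_set A b \<Longrightarrow>
      robustness_cost (feasible_set A b) l u x \<le> robustness_cost (feasible_set A b) l u z"
proof -
  from step obtain \<rho> y where opt: "master_optimal (feasible_set A b) l u \<Omega>' (x, \<rho>)"
    and y: "is_opt (feasible_set A b) (induced_scenario l u x) y"
    and R: "R = induced_scenario l u x \<bullet> x - induced_scenario l u x \<bullet> y"
    and stop: "R \<le> (\<Sum>i\<in>UNIV. real (u $ i) * x $ i) - \<rho>"
    by (cases rule: alg_step.cases) auto
  show x: "x \<in> feasible_set A b"
    using opt by (simp add: master_optimal_iff master_feasible_iff)
  show R': "R = robustness_cost (feasible_set A b) l u x"
    unfolding R using robustness_cost_eq[OF lu x y] by simp
  fix z assume "z \<in> feasible_set A b"
  \<comment> \<open>The chain is R_x \<le> master value \<le> R_z; the first inequality is the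
    stopping test.\<close>
  from master_value_le_robustness_cost[OF lu opt sub this]
  show "robustness_cost (feasible_set A b) l u x \<le> robustness_cost (feasible_set A b) l u z"
    using stop R' by (simp add: master_objective_def)
qed

lemma alg_step_Running_new_cut:
  fixes A :: "real^'n^'m"
  assumes "alg_step (feasible_set A b) l u (Running \<psi> \<Omega>') (Running \<psi>' \<Omega>'')"
  shows "\<exists>y\<in>feasible_set A b - \<Omega>'. \<Omega>'' = insert y \<Omega>'"
proof -
  from assms obtain x \<rho> y where opt: "master_optimal (feasible_set A b) l u \<Omega>' (x, \<rho>)"
    and y: "is_opt (feasible_set A b) (induced_scenario l u x) y"
    and go: "\<not> induced_scenario l u x \<bullet> x - induced_scenario l u x \<bullet> y
               \<le> (\<Sum>i\<in>UNIV. real (u $ i) * x $ i) - \<rho>"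
    and \<Omega>'': "\<Omega>'' = insert y \<Omega>'"
    by (cases rule: alg_step.cases) auto
  have feas: "(x, \<rho>) \<in> master_feasible (feasible_set A b) l u \<Omega>'"
    using opt by (simp add: master_optimal_iff)
  then have x: "x \<in> feasible_set A b" by (simp add: master_feasible_iff)
  \<comment> \<open>If \<open>y\<close> were already a cut, feasibility would give
    \<open>\<rho>\<close> \<le> cost of \<open>y\<close>, hence R_x \<le> lb, and the test would
    have succeeded.\<close>
  have "y \<notin> \<Omega>'"
    using feas go by (auto simp: master_feasible_iff induced_scenario_self[OF x, of u l])
  then show ?thesis
    using y \<Omega>'' by (auto simp: is_opt_iff)
qed

text \<open>This excludes deadlock: all three minimisation problems of an iteration, including the
  choice of \<open>\<rho>\<close>, are solvable, and the tests of the two rules are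
  complementary.\<close>

lemma alg_step_exists:
  fixes A :: "real^'n^'m"
  assumes "\<Omega>' \<subseteq> feasible_set A b" "\<Omega>' \<noteq> {}"
  shows "\<exists>\<sigma>. alg_step (feasible_set A b) l u (Running \<psi> \<Omega>') \<sigma>"
proof -
  have "feasible_set A b \<noteq> {}" "finite \<Omega>'"
    using assms finite_subset[OF _ finite_feasible_set] by auto
  then obtain x \<rho> where opt: "master_optimal (feasible_set A b) l u \<Omega>' (x, \<rho>)"
    using master_optimal_exists[OF _ _ assms(2), of A b l u] by auto
  obtain y where y: "is_opt (feasible_set A b) (induced_scenario l u x) y"
    using is_opt_exists[OF finite_feasible_set \<open>feasible_set A b \<noteq> {}\<close>] by blast
  show ?thesis
    using alg_step.stop[OF opt refl y refl refl] alg_step.continue[OF opt refl y refl refl] by blast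
qed

section \<open>Runs of the algorithm\<close>

lemma not_alg_step_Returned: "\<not> alg_step \<Omega> l u (Returned x R) \<sigma>"
  by (auto elim: alg_step.cases)

text \<open>The loop invariant: nonemptiness makes the master problem solvable, and inclusion makes
  its value a lower bound.\<close>

lemma alg_reachable_Running:
  fixes A :: "real^'n^'m"
  assumes "alg_reachable (feasible_set A b) l u (Running \<psi> \<Omega>')"
  shows "\<Omega>' \<subseteq> feasible_set A b \<and> \<Omega>' \<noteq> {}"
proof -
  obtain \<sigma>\<^sub>0 where init: "alg_init (feasible_set A b) u \<sigma>\<^sub>0"
    and steps: "(alg_step (feasible_set A b) l u)\<^sup>*\<^sup>* \<sigma>\<^sub>0 (Running \<psi> \<Omega>')"
    using assms by (auto simp: alg_reachable_def)
  from steps show ?thesis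
  proof (induction "Running \<psi> \<Omega>'" arbitrary: \<psi> \<Omega>' rule: rtranclp_induct)
    case base
    then show ?case using init by (auto simp: is_opt_iff elim!: alg_init.cases)
  next
    case (step \<sigma>)
    then show ?case
    proof (cases \<sigma>)
      case (Running \<psi>\<^sub>1 \<Omega>\<^sub>1)
      with step show ?thesis using alg_step_Running_new_cut by fast
    next
      case (Returned x R)
      with step show ?thesis by (simp add: not_alg_step_Returned)
    qed
  qed
qed

text \<open>Initial states are \<open>Running\<close>, so a returned state has a last step, to which
  the one-step correctness result applies.\<close>

lemma alg_reachable_ReturnedE:
  assumes "alg_reachable \<Omega> l u (Returned x R)"
  obtains \<psi> \<Omega>' where "alg_reachable \<Omega> l u (Running \<psi> \<Omega>')"
    "alg_step \<Omega> l u (Running \<psi> \<Omega>') (Returned x R)"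
proof -
  obtain \<sigma>\<^sub>0 where init: "alg_init \<Omega> u \<sigma>\<^sub>0" and steps: "(alg_step \<Omega> l u)\<^sup>*\<^sup>* \<sigma>\<^sub>0 (Returned x R)"
    using assms by (auto simp: alg_reachable_def)
  from steps show thesis
  proof (cases rule: rtranclp.cases)
    case rtrancl_refl
    then show ?thesis using init by (auto elim: alg_init.cases)
  next
    case (rtrancl_into_rtrancl \<sigma>)
    then show ?thesis
      using init that by (cases \<sigma>) (auto simp: alg_reachable_def not_alg_step_Returned)
  qed
qed

lemma alg_terminates:
  fixes A :: "real^'n^'m"
  assumes init: "alg_init (feasible_set A b) u (\<sigma> 0)"
    and steps: "\<And>k::nat. alg_step (feasible_set A b) l u (\<sigma> k) (\<sigma> (Suc k))"
  shows False
proof -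
  \<comment> \<open>The inequality is strict because the initial cut set already has one element,
    and each step adds a new one.\<close>
  have "\<exists>\<psi> \<Omega>'. \<sigma> k = Running \<psi> \<Omega>' \<and> \<Omega>' \<subseteq> feasible_set A b \<and> k < card \<Omega>'" for k
  proof (induction k)
    case 0
    show ?case using init by (auto simp: is_opt_iff elim!: alg_init.cases)
  next
    case (Suc k)
    then obtain \<psi> \<Omega>' where k: "\<sigma> k = Running \<psi> \<Omega>'" "\<Omega>' \<subseteq> feasible_set A b" "k < card \<Omega>'"
      by blast
    \<comment> \<open>In an infinite run this state has a successor, so it cannot be
      \<open>Returned\<close>.\<close>
    obtain \<psi>' \<Omega>'' where Suc_k: "\<sigma> (Suc k) = Running \<psi>' \<Omega>''"
      using steps[of "Suc k"] by (cases "\<sigma> (Suc k)") (auto simp: not_alg_step_Returned)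
    then obtain y where "y \<in> feasible_set A b - \<Omega>'" "\<Omega>'' = insert y \<Omega>'"
      using steps[of k] k alg_step_Running_new_cut by metis
    moreover have "finite \<Omega>'" using k(2) finite_feasible_set by (rule finite_subset)
    ultimately show ?case using k Suc_k by auto
  qed
  \<comment> \<open>At this index the cut set would be a subset with more elements than the feasible
    set.\<close>
  from this[of "card (feasible_set A b)"] show False
    using card_mono[OF finite_feasible_set] by (metis not_le)
qed

text \<open>The first three conjuncts together express termination whichever optimal solutions are
  picked: a run can start, never gets stuck before returning, and cannot continue forever.\<close>

theorem theorem1:
  fixes A :: "real^'n^'m" and b :: "real^'m" and l u :: "nat^'n"
    and \<Omega> :: "(real^'n) set"
  defines "\<Omega> \<equiv> feasible_set A b"
  assumes "\<And>i. l $ i \<le> u $ i"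
    and "\<Omega> \<noteq> {}"
  shows "(\<exists>\<sigma>. alg_init \<Omega> u \<sigma>)
    \<and> (\<forall>\<psi> \<Omega>'. alg_reachable \<Omega> l u (Running \<psi> \<Omega>') \<longrightarrow>
          (\<exists>\<sigma>'. alg_step \<Omega> l u (Running \<psi> \<Omega>') \<sigma>'))
    \<and> \<not> (\<exists>\<sigma>. alg_init \<Omega> u (\<sigma> 0) \<and> (\<forall>k::nat. alg_step \<Omega> l u (\<sigma> k) (\<sigma> (Suc k))))
    \<and> (\<forall>x R. alg_reachable \<Omega> l u (Returned x R) \<longrightarrow>
          x \<in> \<Omega>
          \<and> robustness_cost \<Omega> l u x = Min (robustness_cost \<Omega> l u ` \<Omega>)
          \<and> (\<exists>\<rho>. master_optimal \<Omega> l u \<Omega> (x, \<rho>))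
          \<and> R = robustness_cost \<Omega> l u x)"
proof (intro conjI allI impI notI)
  show "\<exists>\<sigma>. alg_init \<Omega> u \<sigma>"
    using is_opt_exists[OF finite_feasible_set] assms(3) alg_init.intros
    unfolding \<Omega>_def by blast
next
  fix \<psi> \<Omega>' assume "alg_reachable \<Omega> l u (Running \<psi> \<Omega>')"
  from alg_reachable_Running[OF this[unfolded \<Omega>_def]]
  show "\<exists>\<sigma>'. alg_step \<Omega> l u (Running \<psi> \<Omega>') \<sigma>'"
    unfolding \<Omega>_def by (intro alg_step_exists) simp_all
next
  assume "\<exists>\<sigma>. alg_init \<Omega> u (\<sigma> 0) \<and> (\<forall>k::nat. alg_step \<Omega> l u (\<sigma> k) (\<sigma> (Suc k)))"
  then obtain \<sigma> where "alg_init \<Omega> u (\<sigma> 0)" "\<And>k::nat. alg_step \<Omega> l u (\<sigma> k) (\<sigma> (Suc k))"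
    by auto
  then show False
    unfolding \<Omega>_def by (rule alg_terminates)
next
  fix x R assume "alg_reachable \<Omega> l u (Returned x R)"
  then obtain \<psi> \<Omega>' where "alg_reachable \<Omega> l u (Running \<psi> \<Omega>')"
    and step: "alg_step \<Omega> l u (Running \<psi> \<Omega>') (Returned x R)"
    by (rule alg_reachable_ReturnedE)
  then have "\<Omega>' \<subseteq> \<Omega>"
    unfolding \<Omega>_def by (simp add: alg_reachable_Running)
  note correct = alg_step_Returned_correct[OF assms(2) step[unfolded \<Omega>_def] this[unfolded \<Omega>_def],
      folded \<Omega>_def]
  show "x \<in> \<Omega>" and "R = robustness_cost \<Omega> l u x"
    by (fact correct)+
  show "robustness_cost \<Omega> l u x = Min (robustness_cost \<Omega> l u ` \<Omega>)"
    using correct(1,3) finite_feasible_set[of A b, folded \<Omega>_def]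
    by (intro Min_eqI[symmetric]) auto
  show "\<exists>\<rho>. master_optimal \<Omega> l u \<Omega> (x, \<rho>)"
    using correct(1,3) unfolding \<Omega>_def by (rule robust_solution_master_optimal[OF assms(2)])
qed

end
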